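(* Let $\mathcal L$, $X$, $Y$ satisfy the standing assumptions listed in the context, and suppose that for some $\tilde\mu>0$ the function $\mathcal L(x,\cdot)$ is $\tilde\mu$-strongly concave for every $x\in X$. Let $x_0\in X$, $y_0\in Y$, let $c\in(0,1]$ and $0<\sigma\le\frac{2}{L_{yy}+\tilde\mu}$ be fixed, and for each number of iterations $K$ let $\{(x_k,y_k)\}_{k\ge0}$ be generated by the algorithm described in the context (CG-RPGA with $\mu=0$) with step-sizes $\tau_k=cK^{-1/2}$ and $\sigma_k=\sigma$ for all $k$. Then there is a constant $C>0$, depending only on $c$, $\sigma$ and the problem instance (the function $\mathcal L$, the sets $X,Y$, the norms, the constants in the assumptions, and $x_0,y_0$) but not on $K$ or $\epsilon$, such that for every integer $K\ge2$ there exists $t\in\{\lceil K/2\rceil,\dots,K-1\}$ for which $(x_t,y_t)\in X\times Y$ and $$\mathcal G_Z(x_t,y_t)\le CK^{-1/2}.$$ Moreover, for every $\epsilon\in(0,1)$, running the algorithm with $K=\lceil C'\epsilon^{-2}\rceil$, where $C'>0$ is a constant with the same dependence as $C$, yields such a $t$ with $\mathcal G_Z(x_t,y_t)\le\epsilon$; i.e., $\mathcal G_Z\le\epsilon$ is achieved within $O(\epsilon^{-2})$ iterations.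
   Context: Setting. $(\mathcal X,\|\cdot\|_{\mathcal X})$ is a finite-dimensional real normed space with dual norm $\|\cdot\|_{\mathcal X^*}$; $\mathcal Y$ is a finite-dimensional real space equipped with the Euclidean norm $\|\cdot\|_{\mathcal Y}=\|\cdot\|_2$. The problem is $\min_{x\in X}\max_{y\in Y}\mathcal L(x,y)$ with $\mathcal L:\mathcal X\times\mathcal Y\to\mathbb R$. Standing assumptions. (I) For every $y\in Y$, $\mathcal L(\cdot,y)$ (possibly nonconvex) is continuously differentiable, and there are $L_{xx}\ge0$, $L_{yx}>0$ with $\|\nabla_x\mathcal L(x,y)-\nabla_x\mathcal L(\bar x,\bar y)\|_{\mathcal X^*}\le L_{xx}\|x-\bar x\|_{\mathcal X}+L_{yx}\|y-\bar y\|_2$ for all $x,\bar x\in X$, $y,\bar y\in Y$. (II) For every $x\in X$, $\mathcal L(x,\cdot)$ is concave and continuously differentiable, and there is $L_{yy}\ge0$ with $\|\nabla_y\mathcal L(x,y)-\nabla_y\mathcal L(\bar x,\bar y)\|_2\le L_{yx}\|x-\bar x\|_{\mathcal X}+L_{yy}\|y-\bar y\|_2$ for all $x,\bar x\in X$, $y,\bar y\in Y$. (III) $X\subseteq\mathcal X$, $Y\subseteq\mathcal Y$ are (nonempty) convex compact sets. $\mathcal L(x,\cdot)$ being $\tilde\mu$-strongly concave means $\mathcal L(x,y')\le\mathcal L(x,y)+\langle\nabla_y\mathcal L(x,y),y'-y\rangle-\frac{\tilde\mu}{2}\|y'-y\|_2^2$ for all $y,y'\in Y$. Notation. $\mathcal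 P_Y$ is the Euclidean projection onto $Y$. Gap functions: $\mathcal G_X(\bar x,\bar y)=\sup_{x\in X}\langle\nabla_x\mathcal L(\bar x,\bar y),\bar x-x\rangle$, $\mathcal G_Y(\bar x,\bar y)=\frac1\sigma\|\bar y-\mathcal P_Y(\bar y+\sigma\nabla_y\mathcal L(\bar x,\bar y))\|_2$ with $\sigma$ the dual step-size, and $\mathcal G_Z=\mathcal G_X+\mathcal G_Y$. Algorithm (CG-RPGA with $\mu=0$). Given $x_0\in X$, $y_0\in Y$ and step-sizes $\tau_k,\sigma_k$, for $k=0,1,\dots$: $s_k\in\operatorname{argmin}_{x\in X}\langle\nabla_x\mathcal L(x_k,y_k),x\rangle$ (arbitrary selection); $x_{k+1}=\tau_ks_k+(1-\tau_k)x_k$; $y_{k+1}=\mathcal P_Y\big(y_k+\sigma_k\nabla_y\mathcal L(x_k,y_k)\big)$. *)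

theory Defs
  imports "HOL-Analysis.Analysis"
begin

text \<open>
  The primal space is a normed space \<open>'a\<close>; its dual is the type \<open>'a \<Rightarrow>\<^sub>L real\<close>, whose norm is the
  operator norm, i.e. the dual norm. The gradient of a function on \<open>'a\<close> is its derivative, an
  element of the dual. The dual space \<open>'b\<close> carries an inner product, and gradients are vectors
  there. Both definitions are meaningful only where the function is differentiable.
\<close>

definition grad_x :: "('a::real_normed_vector \<Rightarrow> 'b \<Rightarrow> real) \<Rightarrow> 'a \<Rightarrow> 'b \<Rightarrow> ('a \<Rightarrow>\<^sub>L real)"
  where "grad_x L x y = Blinfun (frechet_derivative (\<lambda>u. L u y) (at x))"

definition grad_y :: "('a \<Rightarrow> 'b::real_inner \<Rightarrow> real) \<Rightarrow> 'a \<Rightarrow> 'b \<Rightarrow> 'b"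
  where "grad_y L x y = (THE g. GDERIV (L x) y :> g)"

definition strongly_concave_y ::
    "real \<Rightarrow> ('a \<Rightarrow> 'b::real_inner \<Rightarrow> real) \<Rightarrow> 'b set \<Rightarrow> 'a \<Rightarrow> bool"
  where "strongly_concave_y \<mu> L Y x \<longleftrightarrow>
    (\<forall>y\<in>Y. \<forall>y'\<in>Y. L x y' \<le> L x y + grad_y L x y \<bullet> (y' - y) - \<mu> / 2 * (norm (y' - y))\<^sup>2)"

definition gap_X ::
    "('a::real_normed_vector \<Rightarrow> 'b \<Rightarrow> real) \<Rightarrow> 'a set \<Rightarrow> 'a \<Rightarrow> 'b \<Rightarrow> real"
  where "gap_X L X xb yb = (SUP x\<in>X. blinfun_apply (grad_x L xb yb) (xb - x))"

definition gap_Y ::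
    "('a \<Rightarrow> 'b::euclidean_space \<Rightarrow> real) \<Rightarrow> 'b set \<Rightarrow> real \<Rightarrow> 'a \<Rightarrow> 'b \<Rightarrow> real"
  where "gap_Y L Y \<sigma> xb yb =
    1 / \<sigma> * norm (yb - closest_point Y (yb + \<sigma> *\<^sub>R grad_y L xb yb))"

definition gap_Z ::
    "('a::real_normed_vector \<Rightarrow> 'b::euclidean_space \<Rightarrow> real) \<Rightarrow> 'a set \<Rightarrow> 'b set \<Rightarrow> real \<Rightarrow> 'a \<Rightarrow> 'b \<Rightarrow> real"
  where "gap_Z L X Y \<sigma> xb yb = gap_X L X xb yb + gap_Y L Y \<sigma> xb yb"

text \<open>
  \<open>xs\<close>, \<open>ys\<close> is a sequence of iterates of CG-RPGA with \<open>\<mu> = 0\<close>, started at \<open>(x0, y0)\<close>. The minimizer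
  \<open>s\<close> need not be unique, so this is a relation.
\<close>

definition cg_rpga ::
    "('a::real_normed_vector \<Rightarrow> 'b::euclidean_space \<Rightarrow> real) \<Rightarrow> 'a set \<Rightarrow> 'b set \<Rightarrow>
     (nat \<Rightarrow> real) \<Rightarrow> (nat \<Rightarrow> real) \<Rightarrow> 'a \<Rightarrow> 'b \<Rightarrow> (nat \<Rightarrow> 'a) \<Rightarrow> (nat \<Rightarrow> 'b) \<Rightarrow> bool"
  where "cg_rpga L X Y \<tau> \<sigma> x0 y0 xs ys \<longleftrightarrow>
    xs 0 = x0 \<and> ys 0 = y0 \<and>
    (\<forall>k. \<exists>s. is_arg_min (blinfun_apply (grad_x L (xs k) (ys k))) (\<lambda>x. x \<in> X) s \<and>
             xs (Suc k) = \<tau> k *\<^sub>R s + (1 - \<tau> k) *\<^sub>R xs k \<and>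
             ys (Suc k) = closest_point Y (ys k + \<sigma> k *\<^sub>R grad_y L (xs k) (ys k)))"

end

theory Submission
  imports Defs
begin

text \<open>
  Let \<open>\<Phi> x = max\<^sub>Y L x\<close> and let \<open>\<delta> x y = \<Phi> x - L x y\<close> be the dual suboptimality. For
  \<open>\<sigma> \<le> 2 / (Lyy + \<mu>)\<close> a projected ascent step contracts \<open>\<delta> x\<close> by a fixed factor. When \<open>x\<close> moves by
  \<open>O(\<tau>)\<close>, the mean value theorem applied to \<open>L(\<cdot>, y\<^sup>*) - L(\<cdot>, y)\<close>, whose gradient has norm at most
  \<open>Lyx * norm (y\<^sup>* - y) = O(sqrt \<delta>)\<close>, shows that \<open>sqrt \<delta>\<close> changes only by \<open>O(\<tau>)\<close>. Hence
  \<open>sqrt \<delta>\<close> is \<open>O(\<tau>)\<close> after a geometrically decaying transient, and it dominates the dual gap. The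
  Frank-Wolfe step decreases \<open>\<Phi>\<close> by \<open>\<tau> * gap_X - O(\<tau>\<^sup>2 + \<tau> * sqrt \<delta>)\<close>; averaging over the second
  half of the run bounds the primal gap of some iterate.
\<close>

section \<open>Gradients and the quadratic lower bound\<close>

lemma GDERIV_grad_y:
  fixes L :: "'a \<Rightarrow> 'b::euclidean_space \<Rightarrow> real"
  assumes "L x differentiable (at y)"
  shows "GDERIV (L x) y :> grad_y L x y"
proof -
  obtain f' where f': "(L x has_derivative f') (at y)"
    using assms by (auto simp: differentiable_def)
  \<comment> \<open>The Riesz representative of \<open>f'\<close>. Uniqueness of derivatives then
    shows that the definite description in \<open>grad_y\<close> has exactly one solution.\<close>
  define g where "g = (\<Sum>b\<in>Basis. f' b *\<^sub>R b)"
  have lin: "linear f'"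
    using f' has_derivative_linear by blast
  have "f' h = h \<bullet> g" for h
  proof -
    have "f' h = f' (\<Sum>b\<in>Basis. (h \<bullet> b) *\<^sub>R b)"
      by (simp add: euclidean_representation)
    also have "\<dots> = (\<Sum>b\<in>Basis. (h \<bullet> b) * f' b)"
      using lin by (simp add: linear_sum linear_scale)
    also have "\<dots> = h \<bullet> g"
      by (simp add: g_def inner_sum_right mult.commute)
    finally show ?thesis .
  qed
  then have f'_eq: "f' = (\<lambda>h. h \<bullet> g)" by auto
  have "GDERIV (L x) y :> g"
    using f' by (simp add: gderiv_def f'_eq)
  moreover have "g' = g" if "GDERIV (L x) y :> g'" for g'
  proof -
    have "(\<lambda>h. h \<bullet> g') = (\<lambda>h. h \<bullet> g)"
      using that f' has_derivative_unique unfolding gderiv_def f'_eq by blast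
    then have "(g' - g) \<bullet> g' = (g' - g) \<bullet> g" by meson
    then have "(g' - g) \<bullet> (g' - g) = 0" by (simp add: inner_diff_right)
    then show ?thesis by simp
  qed
  ultimately show ?thesis
    unfolding grad_y_def by (rule theI)
qed

lemma has_derivative_grad_x:
  assumes "(\<lambda>u. L u y) differentiable (at x)"
  shows "((\<lambda>u. L u y) has_derivative blinfun_apply (grad_x L x y)) (at x)"
  using assms
  by (simp add: grad_x_def frechet_derivative_works bounded_linear_Blinfun_apply
      has_derivative_bounded_linear)

text \<open>The descent lemma read from below. The Lipschitz estimate is asked for only against the
  base point \<open>y\<close>, since the proof compares each gradient on the segment with
  \<open>g y\<close>.\<close>

lemma Lipschitz_gradient_lower_bound:
  fixes f :: "'b::real_inner \<Rightarrow> real"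
  assumes Y: "convex Y" "y \<in> Y" "z \<in> Y"
    and f: "\<And>u. u \<in> Y \<Longrightarrow> GDERIV f u :> g u"
    and g: "\<And>u. u \<in> Y \<Longrightarrow> norm (g u - g y) \<le> l * norm (u - y)"
  shows "f y + g y \<bullet> (z - y) - l / 2 * (norm (z - y))\<^sup>2 \<le> f z"
proof -
  let ?d = "z - y"
  let ?p = "\<lambda>t::real. y + t *\<^sub>R ?d"
  \<comment> \<open>The quadratic term has derivative \<open>l * t * (norm ?d)\<^sup>2\<close>,
    which bounds how far the slope of \<open>f\<close> along the segment can fall below
    \<open>g y \<bullet> ?d\<close>; hence \<open>?h\<close> is nondecreasing.\<close>
  let ?h = "\<lambda>t. f (?p t) - t * (g y \<bullet> ?d) + l / 2 * t\<^sup>2 * (norm ?d)\<^sup>2"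
  have p: "?p t \<in> Y" if "0 \<le> t" "t \<le> 1" for t
  proof -
    have "?p t = (1 - t) *\<^sub>R y + t *\<^sub>R z" by (simp add: algebra_simps)
    then show ?thesis using Y that by (simp add: convexD_alt)
  qed
  have "?h 0 \<le> ?h 1"
  proof (rule DERIV_nonneg_imp_nondecreasing[where f = ?h and a = 0 and b = 1])
    fix t :: real assume t: "0 \<le> t" "t \<le> 1"
    have "((\<lambda>t. f (?p t)) has_derivative (\<lambda>s. (s *\<^sub>R ?d) \<bullet> g (?p t))) (at t)"
    proof (rule has_derivative_compose[where g = f])
      show "(?p has_derivative (\<lambda>s. s *\<^sub>R ?d)) (at t)"
        by (auto intro!: derivative_eq_intros)
      show "(f has_derivative (\<lambda>h. h \<bullet> g (?p t))) (at (?p t))"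
        using f[OF p[OF t]] by (simp add: gderiv_def)
    qed
    then have "((\<lambda>t. f (?p t)) has_real_derivative g (?p t) \<bullet> ?d) (at t)"
      by (simp add: has_field_derivative_def inner_commute mult_commute_abs)
    then have D: "(?h has_real_derivative
        g (?p t) \<bullet> ?d - g y \<bullet> ?d + l * t * (norm ?d)\<^sup>2) (at t)"
      by (auto intro!: derivative_eq_intros)
    have "(g y - g (?p t)) \<bullet> ?d \<le> norm (g (?p t) - g y) * norm ?d"
      by (metis norm_cauchy_schwarz norm_minus_commute)
    also have "\<dots> \<le> (l * norm (?p t - y)) * norm ?d"
      by (intro mult_right_mono g p t) simp
    also have "\<dots> = l * t * (norm ?d)\<^sup>2"
      using t by (simp add: power2_eq_square)
    finally have "0 \<le> g (?p t) \<bullet> ?d - g y \<bullet> ?d + l * t * (norm ?d)\<^sup>2"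
      by (simp add: inner_diff_left)
    with D show "\<exists>w. (?h has_real_derivative w) (at t) \<and> 0 \<le> w" by blast
  qed simp
  then show ?thesis by simp
qed

section \<open>Contracting real sequences\<close>

lemma geometric_power_le:
  fixes q :: real
  assumes "0 < q" "q < 1" "0 < k"
  shows "q ^ k \<le> 1 / (real k * (1 - q))"
proof -
  have "real k * (1 - q) \<le> real k * (1 / q - 1)"
  proof (rule mult_left_mono)
    have "(1 - q) * q \<le> (1 - q) * 1" using assms by (intro mult_left_mono) auto
    then show "1 - q \<le> 1 / q - 1" using assms by (simp add: field_simps)
  qed simp
  also have "\<dots> \<le> (1 / q) ^ k"
    \<comment> \<open>Bernoulli for \<open>1 / q\<close> trades geometric decay for a
      \<open>1/k\<close> rate, which is enough here and gives a constant explicit in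
      \<open>q\<close>.\<close>
    using Bernoulli_inequality[of "1 / q - 1" k] assms by simp
  finally have "real k * (1 - q) \<le> 1 / q ^ k" by (simp add: power_one_over)
  then show ?thesis using assms by (simp add: field_simps)
qed

text \<open>\<open>a / (1 - q)\<close> is the fixed point of the map
  \<open>r \<mapsto> q * r + a\<close>, so only the initial value is damped geometrically.\<close>

lemma affine_recursion_le:
  fixes r :: "nat \<Rightarrow> real"
  assumes q: "0 \<le> q" "q < 1" and "0 \<le> a" and r: "\<And>k. r (Suc k) \<le> q * r k + a"
  shows "r k \<le> q ^ k * r 0 + a / (1 - q)"
proof (induction k)
  case 0
  show ?case using assms by simp
next
  case (Suc k)
  have "r (Suc k) \<le> q * (q ^ k * r 0 + a / (1 - q)) + a"
    using r[of k] mult_left_mono[OF Suc q(1)] by linarith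
  also have "\<dots> = q ^ Suc k * r 0 + a / (1 - q)"
    using q by (simp add: field_simps)
  finally show ?case .
qed

section \<open>The max function and the dual suboptimality\<close>

locale nonconvex_strongly_concave =
  fixes L :: "'a::real_normed_vector \<Rightarrow> 'b::euclidean_space \<Rightarrow> real"
    and X :: "'a set" and Y :: "'b set" and Lxx Lyx Lyy \<mu> D :: real
  assumes X: "convex X" and Y: "Y \<noteq> {}" "convex Y" "compact Y"
    and nonneg: "Lxx \<ge> 0" "Lyx \<ge> 0" "Lyy \<ge> 0" "D \<ge> 0" and mu: "\<mu> > 0"
    and diam: "x \<in> X \<Longrightarrow> x' \<in> X \<Longrightarrow> norm (x - x') \<le> D"
    and diff_x: "x \<in> X \<Longrightarrow> y \<in> Y \<Longrightarrow> (\<lambda>u. L u y) differentiable (at x)"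
    and lip_x: "x \<in> X \<Longrightarrow> x' \<in> X \<Longrightarrow> y \<in> Y \<Longrightarrow> y' \<in> Y \<Longrightarrow>
      norm (grad_x L x y - grad_x L x' y') \<le> Lxx * norm (x - x') + Lyx * norm (y - y')"
    and diff_y: "x \<in> X \<Longrightarrow> y \<in> Y \<Longrightarrow> L x differentiable (at y)"
    and lip_y: "x \<in> X \<Longrightarrow> y \<in> Y \<Longrightarrow> y' \<in> Y \<Longrightarrow>
      norm (grad_y L x y - grad_y L x y') \<le> Lyy * norm (y - y')"
    and concave: "x \<in> X \<Longrightarrow> strongly_concave_y \<mu> L Y x"
begin

definition ymax :: "'a \<Rightarrow> 'b"
  where "ymax x = (SOME y. y \<in> Y \<and> (\<forall>z\<in>Y. L x z \<le> L x y))"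

definition \<Phi> :: "'a \<Rightarrow> real"
  where "\<Phi> x = L x (ymax x)"

definition \<delta> :: "'a \<Rightarrow> 'b \<Rightarrow> real"
  where "\<delta> x y = \<Phi> x - L x y"

text \<open>Converts suboptimality into distance: a bound
  \<open>\<mu> / 2 * d\<^sup>2 \<le> \<delta>\<close> gives
  \<open>d \<le> \<kappa> * sqrt \<delta>\<close>.\<close>

definition \<kappa> :: real
  where "\<kappa> = sqrt (2 / \<mu>)"

lemma kappa_nonneg: "\<kappa> \<ge> 0"
  using mu by (simp add: \<kappa>_def)

lemma GDERIV_L: "x \<in> X \<Longrightarrow> y \<in> Y \<Longrightarrow> GDERIV (L x) y :> grad_y L x y"
  by (rule GDERIV_grad_y) (rule diff_y)

lemma has_derivative_L:
  "x \<in> X \<Longrightarrow> y \<in> Y \<Longrightarrow>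
    ((\<lambda>u. L u y) has_derivative blinfun_apply (grad_x L x y)) (at x)"
  by (rule has_derivative_grad_x) (rule diff_x)

lemma ymax:
  assumes "x \<in> X"
  shows "ymax x \<in> Y" and "z \<in> Y \<Longrightarrow> L x z \<le> \<Phi> x"
proof -
  have "continuous_on Y (L x)"
    using diff_y[OF assms]
    by (meson continuous_at_imp_continuous_on differentiable_imp_continuous_within)
  then have "\<exists>y. y \<in> Y \<and> (\<forall>z\<in>Y. L x z \<le> L x y)"
    using continuous_attains_sup Y by blast
  then have *: "ymax x \<in> Y \<and> (\<forall>z\<in>Y. L x z \<le> L x (ymax x))"
    unfolding ymax_def by (rule someI_ex)
  then show "ymax x \<in> Y" by blast
  show "L x z \<le> \<Phi> x" if "z \<in> Y" using that * by (simp add: \<Phi>_def)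
qed

lemma delta_nonneg: "x \<in> X \<Longrightarrow> y \<in> Y \<Longrightarrow> 0 \<le> \<delta> x y"
  using ymax(2) by (simp add: \<delta>_def)

text \<open>Freezing the dual variable at the maximizer for \<open>x'\<close> only lowers the value
  at \<open>x\<close>. This replaces differentiating \<open>\<Phi>\<close>.\<close>

lemma Phi_diff_le:
  assumes "x \<in> X" "x' \<in> X"
  shows "\<Phi> x' - \<Phi> x \<le> L x' (ymax x') - L x (ymax x')"
  using ymax[OF assms(1)] ymax[OF assms(2)] by (simp add: \<Phi>_def)

section \<open>Strong concavity and the projected ascent step\<close>

lemma strongly_concave:
  "x \<in> X \<Longrightarrow> y \<in> Y \<Longrightarrow> z \<in> Y \<Longrightarrow>
    L x z \<le> L x y + grad_y L x y \<bullet> (z - y) - \<mu> / 2 * (norm (z - y))\<^sup>2"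
  using concave by (simp add: strongly_concave_y_def)

text \<open>If the slope towards \<open>z\<close> were positive, the quadratic lower bound would
  make a short step towards \<open>z\<close> beat the maximum.\<close>

lemma ymax_first_order:
  assumes x: "x \<in> X" and z: "z \<in> Y"
  shows "grad_y L x (ymax x) \<bullet> (z - ymax x) \<le> 0"
proof (rule ccontr)
  let ?y = "ymax x" and ?g = "grad_y L x"
  define d where "d = z - ?y"
  note y = ymax(1)[OF x]
  assume "\<not> ?thesis"
  then have pos: "?g ?y \<bullet> d > 0" by (simp add: d_def)
  define B where "B = Lyy * (norm d)\<^sup>2"
  have B: "B \<ge> 0" using nonneg by (simp add: B_def)
  \<comment> \<open>The cap 1 keeps the point in \<open>Y\<close>. The other bound makes the loss
    \<open>t * B / 2\<close> smaller than the slope, and \<open>B + 1\<close> avoids a zero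
    denominator.\<close>
  define t where "t = min 1 (?g ?y \<bullet> d / (B + 1))"
  have t: "0 < t" "t \<le> 1" using pos B by (auto simp: t_def)
  have p: "?y + t *\<^sub>R d \<in> Y"
  proof -
    have "?y + t *\<^sub>R d = (1 - t) *\<^sub>R ?y + t *\<^sub>R z" by (simp add: d_def algebra_simps)
    then show ?thesis using Y y z t by (simp add: convexD_alt)
  qed
  have "L x ?y + ?g ?y \<bullet> (t *\<^sub>R d) - Lyy / 2 * (norm (t *\<^sub>R d))\<^sup>2 \<le> L x (?y + t *\<^sub>R d)"
    using Lipschitz_gradient_lower_bound[OF Y(2) y p GDERIV_L[OF x] lip_y[OF x _ y]] by simp
  then have "?g ?y \<bullet> (t *\<^sub>R d) - Lyy / 2 * (norm (t *\<^sub>R d))\<^sup>2 \<le> 0"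
    using ymax(2)[OF x p] by (simp add: \<Phi>_def)
  then have "t * (?g ?y \<bullet> d - t * B / 2) \<le> 0"
    by (simp add: B_def power_mult_distrib power2_eq_square algebra_simps)
  then have "?g ?y \<bullet> d \<le> t * B / 2"
    using t by (simp add: mult_le_0_iff)
  also have "\<dots> \<le> (?g ?y \<bullet> d / (B + 1)) * B / 2"
    using B by (intro divide_right_mono mult_right_mono) (auto simp: t_def)
  also have "\<dots> < ?g ?y \<bullet> d"
  proof -
    have "B / (2 * (B + 1)) < 1" using B by (simp add: field_simps)
    from mult_strict_left_mono[OF this pos] show ?thesis by (simp add: field_simps)
  qed
  finally show False by simp
qed

text \<open>Quadratic growth: in the strong concavity inequality based at the maximizer, the linear
  term is nonpositive.\<close>

lemma dist_ymax_le:
  assumes "x \<in> X" "y \<in> Y"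
  shows "norm (ymax x - y) \<le> \<kappa> * sqrt (\<delta> x y)"
proof -
  have "\<mu> / 2 * (norm (y - ymax x))\<^sup>2 \<le> \<delta> x y"
    using strongly_concave[OF assms(1) ymax(1)[OF assms(1)] assms(2)] ymax_first_order[OF assms]
    by (simp add: \<delta>_def \<Phi>_def)
  then have "(norm (ymax x - y))\<^sup>2 \<le> 2 / \<mu> * \<delta> x y"
    using mu by (simp add: norm_minus_commute field_simps)
  then show ?thesis
    unfolding \<kappa>_def real_sqrt_mult[symmetric] by (rule real_le_rsqrt)
qed

text \<open>With \<open>a\<close> the length of the step, the step gains at least
  \<open>\<mu> / 2 * a\<^sup>2\<close>, while the suboptimality left is at most
  \<open>a\<^sup>2 / (2 * \<mu> * \<sigma>\<^sup>2)\<close>. Eliminating \<open>a\<close> gives the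
  contraction of \<open>\<delta>\<close>; the factor for \<open>sqrt \<delta>\<close> is its
  root.\<close>

lemma ascent_step:
  assumes x: "x \<in> X" and y: "y \<in> Y" and \<sigma>: "0 < \<sigma>" "\<sigma> \<le> 2 / (Lyy + \<mu>)"
  defines "y' \<equiv> closest_point Y (y + \<sigma> *\<^sub>R grad_y L x y)"
  shows "y' \<in> Y"
    and "norm (y' - y) \<le> \<kappa> * sqrt (\<delta> x y)"
    and "sqrt (\<delta> x y') \<le> 1 / sqrt (1 + \<mu>\<^sup>2 * \<sigma>\<^sup>2) * sqrt (\<delta> x y)"
proof -
  let ?g = "grad_y L x y" and ?s = "ymax x"
  define a where "a = norm (y' - y)"
  define b where "b = norm (?s - y)"
  have clY: "closed Y" using Y(3) by (rule compact_imp_closed)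
  show y': "y' \<in> Y" unfolding y'_def by (rule closest_point_in_set[OF clY Y(1)])
  have s: "?s \<in> Y" using ymax(1)[OF x] .
  \<comment> \<open>Variational inequality of the projection. At \<open>z = y\<close> it bounds the
    gain from below; at \<open>z = ymax x\<close> it limits how far \<open>y'\<close> is from
    optimal.\<close>
  have proj: "(y + \<sigma> *\<^sub>R ?g - y') \<bullet> (z - y') \<le> 0" if "z \<in> Y" for z
    unfolding y'_def by (rule closest_point_dot[OF Y(2) clY that])
  have "\<sigma> * (?g \<bullet> (y' - y)) \<ge> a\<^sup>2"
    using proj[OF y] unfolding a_def
    by (simp add: power2_norm_eq_inner inner_simps inner_commute algebra_simps)
  then have up: "?g \<bullet> (y' - y) \<ge> a\<^sup>2 / \<sigma>"
    using \<sigma> by (simp add: field_simps)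
  have smooth: "L x y' \<ge> L x y + ?g \<bullet> (y' - y) - Lyy / 2 * a\<^sup>2"
    unfolding a_def
    by (rule Lipschitz_gradient_lower_bound[OF Y(2) y y' GDERIV_L[OF x]
          lip_y[OF x _ y]])
  \<comment> \<open>The step-size condition leaves a margin of \<open>\<mu> / 2\<close> between
    \<open>1 / \<sigma>\<close> and \<open>Lyy / 2\<close>.\<close>
  have "\<sigma> * (Lyy + \<mu>) \<le> 2" using \<sigma>(2) mu nonneg by (simp add: field_simps)
  then have "(Lyy + \<mu>) / 2 \<le> 1 / \<sigma>" using \<sigma>(1) by (simp add: field_simps)
  then have step: "Lyy / 2 * a\<^sup>2 - a\<^sup>2 / \<sigma> \<le> - (\<mu> / 2 * a\<^sup>2)"
    using mult_right_mono[of "(Lyy + \<mu>) / 2" "1 / \<sigma>" "a\<^sup>2"] by (simp add: field_simps)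
  have decrease: "\<mu> / 2 * a\<^sup>2 \<le> \<delta> x y - \<delta> x y'"
    using up smooth step by (simp add: \<delta>_def)
  have "(norm (y' - y))\<^sup>2 \<le> 2 / \<mu> * \<delta> x y"
    using decrease delta_nonneg[OF x y'] mu by (simp add: field_simps a_def)
  then show "norm (y' - y) \<le> \<kappa> * sqrt (\<delta> x y)"
    unfolding \<kappa>_def real_sqrt_mult[symmetric] by (rule real_le_rsqrt)
  have "\<sigma> * (?g \<bullet> (?s - y')) \<le> (y' - y) \<bullet> (?s - y')"
    using proj[OF s] by (simp add: inner_simps algebra_simps)
  also have "\<dots> = (y' - y) \<bullet> (?s - y) - a\<^sup>2"
    by (simp add: a_def power2_norm_eq_inner inner_simps)
  also have "\<dots> \<le> a * b - a\<^sup>2"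
    unfolding a_def b_def using norm_cauchy_schwarz[of "y' - y" "?s - y"] by simp
  finally have opt: "?g \<bullet> (?s - y') \<le> a * b / \<sigma> - a\<^sup>2 / \<sigma>"
    using \<sigma>(1) by (simp add: field_simps)
  have "?g \<bullet> (?s - y) = ?g \<bullet> (?s - y') + ?g \<bullet> (y' - y)"
    by (simp add: inner_simps)
  then have "\<delta> x y' \<le> a * b / \<sigma> - \<mu> / 2 * b\<^sup>2 - \<mu> / 2 * a\<^sup>2"
    using strongly_concave[OF x y s] opt smooth step
    unfolding \<delta>_def \<Phi>_def b_def[symmetric] by linarith
  also have "\<dots> \<le> a\<^sup>2 / (2 * \<mu> * \<sigma>\<^sup>2)"
  proof -
    \<comment> \<open>Completing the square removes the unknown distance \<open>b\<close> to the
      maximizer.\<close>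
    have "0 \<le> \<mu> / 2 * (b - a / (\<mu> * \<sigma>))\<^sup>2" using mu by simp
    also have "\<dots> = \<mu> / 2 * b\<^sup>2 - a * b / \<sigma> + a\<^sup>2 / (2 * \<mu> * \<sigma>\<^sup>2)"
      using mu \<sigma>(1) by (simp add: power2_eq_square field_simps)
    finally have "a * b / \<sigma> - \<mu> / 2 * b\<^sup>2 \<le> a\<^sup>2 / (2 * \<mu> * \<sigma>\<^sup>2)" by linarith
    moreover have "0 \<le> \<mu> / 2 * a\<^sup>2" using mu by simp
    ultimately show ?thesis by linarith
  qed
  finally have "\<mu>\<^sup>2 * \<sigma>\<^sup>2 * \<delta> x y' \<le> \<mu> / 2 * a\<^sup>2"
    using mu \<sigma>(1) by (simp add: power2_eq_square field_simps)
  with decrease have "(1 + \<mu>\<^sup>2 * \<sigma>\<^sup>2) * \<delta> x y' \<le> \<delta> x y"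
    by (simp add: algebra_simps)
  then have "sqrt (1 + \<mu>\<^sup>2 * \<sigma>\<^sup>2) * sqrt (\<delta> x y') \<le> sqrt (\<delta> x y)"
    unfolding real_sqrt_mult[symmetric] by (rule real_sqrt_le_mono)
  moreover have "0 < sqrt (1 + \<mu>\<^sup>2 * \<sigma>\<^sup>2)"
    by (simp add: add_pos_nonneg)
  ultimately show "sqrt (\<delta> x y') \<le> 1 / sqrt (1 + \<mu>\<^sup>2 * \<sigma>\<^sup>2) * sqrt (\<delta> x y)"
    by (simp add: field_simps)
qed

section \<open>Moving the primal variable\<close>

lemma mixed_difference_le:
  assumes x: "x \<in> X" "x' \<in> X" and y: "y \<in> Y" "y' \<in> Y"
  shows "(L x' y' - L x' y) - (L x y' - L x y) \<le> Lyx * norm (y' - y) * norm (x' - x)"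
proof -
  have "norm ((L x' y' - L x' y) - (L x y' - L x y)) \<le> Lyx * norm (y' - y) * norm (x' - x)"
  proof (rule differentiable_bound[OF X _ _ x(2,1)])
    fix u assume u: "u \<in> X"
    show "((\<lambda>u. L u y' - L u y) has_derivative
        blinfun_apply (grad_x L u y' - grad_x L u y)) (at u within X)"
      using has_derivative_diff[OF has_derivative_L[OF u y(2)]
          has_derivative_L[OF u y(1)]]
      by (auto intro: has_derivative_at_withinI simp: blinfun.diff_left[symmetric])
    show "onorm (blinfun_apply (grad_x L u y' - grad_x L u y)) \<le> Lyx * norm (y' - y)"
      using lip_x[OF u u y(2,1)] by (simp add: norm_blinfun.rep_eq[symmetric])
  qed
  then show ?thesis by simp
qed

text \<open>The gradient is taken at the current dual point \<open>y\<close>, while the function is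
  compared at \<open>y'\<close>; the \<open>Lyx\<close> term pays for this mismatch.\<close>

lemma linearization_le:
  assumes x: "x \<in> X" "x' \<in> X" and y: "y \<in> Y" "y' \<in> Y"
  shows "L x' y' - L x y' \<le> blinfun_apply (grad_x L x y) (x' - x) +
    (Lxx * norm (x' - x) + Lyx * norm (y' - y)) * norm (x' - x)"
proof -
  let ?G = "blinfun_apply (grad_x L x y)"
  \<comment> \<open>Working on the segment instead of \<open>X\<close> gives
    \<open>norm (u - x) \<le> norm (x' - x)\<close>.\<close>
  let ?S = "closed_segment x x'"
  have S: "?S \<subseteq> X" using closed_segment_subset[OF x X] .
  have "norm ((L x' y' - ?G x') - (L x y' - ?G x))
      \<le> (Lxx * norm (x' - x) + Lyx * norm (y' - y)) * norm (x' - x)"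
  proof (rule differentiable_bound[where S = ?S])
    fix u assume u: "u \<in> ?S"
    then have uX: "u \<in> X" using S by blast
    show "((\<lambda>u. L u y' - ?G u) has_derivative
        blinfun_apply (grad_x L u y' - grad_x L x y)) (at u within ?S)"
      using has_derivative_diff[OF has_derivative_L[OF uX y(2)]
          bounded_linear_imp_has_derivative[OF blinfun.bounded_linear_right]]
      by (auto intro: has_derivative_at_withinI simp: blinfun.diff_left[symmetric])
    have "norm (grad_x L u y' - grad_x L x y) \<le> Lxx * norm (u - x) + Lyx * norm (y' - y)"
      by (rule lip_x[OF uX x(1) y(2,1)])
    also have "\<dots> \<le> Lxx * norm (x' - x) + Lyx * norm (y' - y)"
      using segment_bound(1)[OF u] nonneg by (intro add_mono mult_left_mono) auto
    finally show "onorm (blinfun_apply (grad_x L u y' - grad_x L x y))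
        \<le> Lxx * norm (x' - x) + Lyx * norm (y' - y)"
      by (simp add: norm_blinfun.rep_eq[symmetric])
  qed auto
  then show ?thesis by (simp add: blinfun.diff_right)
qed

text \<open>The distance from \<open>y\<close> to \<open>ymax x'\<close> is itself bounded by
  \<open>\<kappa> * ?u\<close>, so the mixed difference yields
  \<open>?u * ?u \<le> ?v * ?v + ?w * ?u\<close>. Solving for \<open>?u\<close> turns this into an
  additive error.\<close>

lemma sqrt_delta_le:
  assumes x: "x \<in> X" "x' \<in> X" and y: "y \<in> Y"
  shows "sqrt (\<delta> x' y) \<le> sqrt (\<delta> x y) + Lyx * \<kappa> * norm (x' - x)"
proof -
  let ?u = "sqrt (\<delta> x' y)" and ?v = "sqrt (\<delta> x y)" and ?w = "Lyx * \<kappa> * norm (x' - x)"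
  have w: "0 \<le> ?w" using nonneg kappa_nonneg by simp
  note s = ymax(1)[OF x(2)]
  have "\<delta> x' y - \<delta> x y \<le> Lyx * norm (ymax x' - y) * norm (x' - x)"
    using Phi_diff_le[OF x] mixed_difference_le[OF x y s] by (simp add: \<delta>_def)
  also have "\<dots> \<le> Lyx * (\<kappa> * ?u) * norm (x' - x)"
    using dist_ymax_le[OF x(2) y] nonneg by (intro mult_right_mono mult_left_mono) auto
  finally have *: "?u * ?u \<le> ?v * ?v + ?w * ?u"
    using delta_nonneg[OF x(1) y] delta_nonneg[OF x(2) y]
    by (simp add: mult.assoc mult.left_commute mult.commute)
  show ?thesis
  proof (rule ccontr)
    assume "\<not> ?thesis"
    then have gt: "?u - ?w > ?v" by linarith
    have v: "0 \<le> ?v" using delta_nonneg[OF x(1) y] by simp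
    have "?v * ?v < (?u - ?w) * (?u - ?w)" using gt v by (intro mult_strict_mono') assumption+
    also have "\<dots> \<le> (?u - ?w) * ?u" using gt v w by (intro mult_left_mono) linarith+
    finally show False using * by (simp add: algebra_simps)
  qed
qed

text \<open>Bounds the total decrease available to a telescoping sum of \<open>\<Phi>\<close>. The
  gradient at \<open>(x0, y0)\<close> and the Lipschitz estimate bound the primal gradient uniformly
  on \<open>X\<close> and \<open>Y\<close>.\<close>

lemma Phi_oscillation_le:
  assumes x: "x \<in> X" "x' \<in> X" and x0: "x0 \<in> X" and y0: "y0 \<in> Y"
    and E: "\<And>y. y \<in> Y \<Longrightarrow> norm (y - y0) \<le> E"
  shows "\<Phi> x - \<Phi> x' \<le> (norm (grad_x L x0 y0) + Lxx * D + Lyx * E) * D"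
proof -
  let ?B = "norm (grad_x L x0 y0) + Lxx * D + Lyx * E"
  note s = ymax(1)[OF x(1)]
  have "norm (L x (ymax x) - L x' (ymax x)) \<le> ?B * norm (x - x')"
  proof (rule differentiable_bound[OF X _ _ x])
    fix u assume u: "u \<in> X"
    show "((\<lambda>u. L u (ymax x)) has_derivative blinfun_apply (grad_x L u (ymax x))) (at u within X)"
      using has_derivative_L[OF u s] by (rule has_derivative_at_withinI)
    have "norm (grad_x L u (ymax x)) \<le> norm (grad_x L x0 y0) +
        norm (grad_x L u (ymax x) - grad_x L x0 y0)"
      by (metis add_diff_cancel_left' diff_add_cancel norm_triangle_ineq add.commute)
    also have "\<dots> \<le> norm (grad_x L x0 y0) +
        (Lxx * norm (u - x0) + Lyx * norm (ymax x - y0))"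
      using lip_x[OF u x0 s y0] by simp
    also have "\<dots> \<le> norm (grad_x L x0 y0) + (Lxx * D + Lyx * E)"
      using diam[OF u x0] E[OF s] nonneg by (intro add_mono mult_left_mono) auto
    finally show "onorm (blinfun_apply (grad_x L u (ymax x))) \<le> ?B"
      by (simp add: norm_blinfun.rep_eq[symmetric])
  qed
  moreover have "0 \<le> E" using E[OF y0] by simp
  then have "0 \<le> ?B" using nonneg by simp
  then have "?B * norm (x - x') \<le> ?B * D"
    using diam[OF x] by (intro mult_left_mono) auto
  ultimately show ?thesis using Phi_diff_le[OF x(2,1)] by simp
qed

text \<open>The direction \<open>s\<close> is optimal for the gradient at \<open>y\<close>, whereas
  the change of \<open>\<Phi>\<close> is measured at \<open>ymax x'\<close>. Linearizing across
  these two dual points produces the error term.\<close>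

lemma frank_wolfe_step:
  assumes x: "x \<in> X" "s \<in> X" and y: "y \<in> Y" "y' \<in> Y" and \<tau>: "0 \<le> \<tau>" "\<tau> \<le> 1"
    and s: "\<And>z. z \<in> X \<Longrightarrow> blinfun_apply (grad_x L x y) s \<le> blinfun_apply (grad_x L x y) z"
    and y'_y: "norm (y' - y) \<le> \<kappa> * sqrt (\<delta> x y)"
  defines "x' \<equiv> \<tau> *\<^sub>R s + (1 - \<tau>) *\<^sub>R x"
  shows "\<tau> * gap_X L X x y \<le> \<Phi> x - \<Phi> x' +
    (Lxx * (\<tau> * D) + Lyx * (\<kappa> * (sqrt (\<delta> x y) + sqrt (\<delta> x' y')))) * (\<tau> * D)"
proof -
  let ?G = "blinfun_apply (grad_x L x y)"
  have x': "x' \<in> X" unfolding x'_def using convexD[OF X x(2,1), of \<tau> "1 - \<tau>"] \<tau> by simp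
  have d: "x' - x = \<tau> *\<^sub>R (s - x)" by (simp add: x'_def algebra_simps)
  have n: "norm (x' - x) \<le> \<tau> * D"
    using diam[OF x(2,1)] \<tau> by (simp add: d mult_left_mono)
  have r: "0 \<le> sqrt (\<delta> x y)" "0 \<le> sqrt (\<delta> x' y')"
    using delta_nonneg x(1) x' y by auto
  have "gap_X L X x y \<le> ?G (x - s)"
    unfolding gap_X_def using x s
    by (intro cSUP_least) (auto simp: blinfun.diff_right)
  then have "\<tau> * gap_X L X x y \<le> \<tau> * ?G (x - s)" using \<tau> by (intro mult_left_mono)
  also have "\<dots> = - ?G (x' - x)"
    by (simp add: d blinfun.scaleR_right blinfun.diff_right algebra_simps)
  finally have gap: "\<tau> * gap_X L X x y \<le> - ?G (x' - x)" .
  \<comment> \<open>Passing through \<open>y'\<close> uses the ascent step length at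
    \<open>x\<close> and quadratic growth at \<open>x'\<close>; this is why both the old and the new
    suboptimality occur.\<close>
  have "norm (ymax x' - y) \<le> norm (ymax x' - y') + norm (y' - y)"
    by (metis diff_add_cancel add_diff_eq norm_triangle_ineq)
  also have "\<dots> \<le> \<kappa> * (sqrt (\<delta> x y) + sqrt (\<delta> x' y'))"
    using y'_y dist_ymax_le[OF x' y(2)] by (simp add: algebra_simps)
  finally have "(Lxx * norm (x' - x) + Lyx * norm (ymax x' - y)) * norm (x' - x)
      \<le> (Lxx * (\<tau> * D) + Lyx * (\<kappa> * (sqrt (\<delta> x y) + sqrt (\<delta> x' y')))) * (\<tau> * D)"
    using n nonneg kappa_nonneg r \<tau>
    by (intro mult_mono add_mono add_nonneg_nonneg mult_nonneg_nonneg) auto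
  then show ?thesis
    using gap Phi_diff_le[OF x(1) x'] linearization_le[OF x(1) x' y(1) ymax(1)[OF x']] by linarith
qed

section \<open>Recursions along the run and the gap bound\<close>

lemma cg_rpga_iterates:
  assumes run: "cg_rpga L X Y (\<lambda>_. \<tau>) (\<lambda>_. \<sigma>) x0 y0 xs ys"
    and init: "x0 \<in> X" "y0 \<in> Y" and \<tau>: "0 \<le> \<tau>" "\<tau> \<le> 1"
  shows "xs k \<in> X" and "ys k \<in> Y"
proof -
  have "xs k \<in> X \<and> ys k \<in> Y"
  proof (induction k)
    case 0
    show ?case using run init by (simp add: cg_rpga_def)
  next
    case (Suc k)
    obtain s where "is_arg_min (blinfun_apply (grad_x L (xs k) (ys k))) (\<lambda>x. x \<in> X) s"
      and x: "xs (Suc k) = \<tau> *\<^sub>R s + (1 - \<tau>) *\<^sub>R xs k"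
      and y: "ys (Suc k) = closest_point Y (ys k + \<sigma> *\<^sub>R grad_y L (xs k) (ys k))"
      using run unfolding cg_rpga_def by meson
    then have "s \<in> X" by (simp add: is_arg_min_def)
    then show ?case
      using x y Suc convexD[OF X, of s "xs k" \<tau> "1 - \<tau>"] \<tau>
        closest_point_in_set[OF compact_imp_closed[OF Y(3)] Y(1)] by simp
  qed
  then show "xs k \<in> X" and "ys k \<in> Y" by auto
qed

lemma cg_rpga_step:
  assumes run: "cg_rpga L X Y (\<lambda>_. \<tau>) (\<lambda>_. \<sigma>) x0 y0 xs ys"
    and init: "x0 \<in> X" "y0 \<in> Y" and \<tau>: "0 \<le> \<tau>" "\<tau> \<le> 1"
    and \<sigma>: "0 < \<sigma>" "\<sigma> \<le> 2 / (Lyy + \<mu>)"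
  defines "r \<equiv> \<lambda>k. sqrt (\<delta> (xs k) (ys k))"
  shows "r (Suc k) \<le> 1 / sqrt (1 + \<mu>\<^sup>2 * \<sigma>\<^sup>2) * r k + Lyx * \<kappa> * D * \<tau>"
    and "gap_Y L Y \<sigma> (xs k) (ys k) \<le> \<kappa> / \<sigma> * r k"
    and "\<tau> * gap_X L X (xs k) (ys k) \<le> \<Phi> (xs k) - \<Phi> (xs (Suc k)) +
      (Lxx * (\<tau> * D) + Lyx * (\<kappa> * (r k + r (Suc k)))) * (\<tau> * D)"
proof -
  note mem = cg_rpga_iterates[OF run init \<tau>]
  obtain s where s: "is_arg_min (blinfun_apply (grad_x L (xs k) (ys k))) (\<lambda>x. x \<in> X) s"
    and x: "xs (Suc k) = \<tau> *\<^sub>R s + (1 - \<tau>) *\<^sub>R xs k"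
    and y: "ys (Suc k) = closest_point Y (ys k + \<sigma> *\<^sub>R grad_y L (xs k) (ys k))"
    using run unfolding cg_rpga_def by meson
  have sX: "s \<in> X"
    and smin: "\<And>z. z \<in> X \<Longrightarrow> blinfun_apply (grad_x L (xs k) (ys k)) s
      \<le> blinfun_apply (grad_x L (xs k) (ys k)) z"
    using s by (auto simp: is_arg_min_def not_less)
  note asc = ascent_step[OF mem(1)[of k] mem(2)[of k] \<sigma>, folded y]
  have "norm (xs (Suc k) - xs k) = \<tau> * norm (s - xs k)"
    using \<tau> by (simp add: x algebra_simps flip: scaleR_right_diff_distrib)
  then have "norm (xs (Suc k) - xs k) \<le> D * \<tau>"
    using mult_left_mono[OF diam[OF sX mem(1)[of k]] \<tau>(1)] by (simp add: mult.commute)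
  then have "Lyx * \<kappa> * norm (xs (Suc k) - xs k) \<le> Lyx * \<kappa> * (D * \<tau>)"
    using nonneg kappa_nonneg by (intro mult_left_mono) auto
  \<comment> \<open>First the dual step contracts at the old \<open>xs k\<close>; then the primal
    point moves with \<open>ys (Suc k)\<close> held fixed.\<close>
  then show "r (Suc k) \<le> 1 / sqrt (1 + \<mu>\<^sup>2 * \<sigma>\<^sup>2) * r k + Lyx * \<kappa> * D * \<tau>"
    using sqrt_delta_le[OF mem(1)[of k] mem(1)[of "Suc k"] asc(1)] asc(3)
    by (simp add: r_def)
  \<comment> \<open>The dual gap is exactly the length of the projected step divided by
    \<open>\<sigma>\<close>.\<close>
  show "gap_Y L Y \<sigma> (xs k) (ys k) \<le> \<kappa> / \<sigma> * r k"
    using asc(2) \<sigma>(1) unfolding gap_Y_def y[symmetric] r_def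
    by (simp add: norm_minus_commute divide_right_mono)
  show "\<tau> * gap_X L X (xs k) (ys k) \<le> \<Phi> (xs k) - \<Phi> (xs (Suc k)) +
      (Lxx * (\<tau> * D) + Lyx * (\<kappa> * (r k + r (Suc k)))) * (\<tau> * D)"
    unfolding r_def
    using frank_wolfe_step[OF mem(1)[of k] sX mem(2)[of k] asc(1) \<tau> smin asc(2)] by (simp add: x)
qed

text \<open>All constants are fixed before \<open>K\<close> and the run, so the bound is uniform in
  both.\<close>

lemma cg_rpga_gap_bound:
  assumes init: "x0 \<in> X" "y0 \<in> Y" and c: "0 < c" "c \<le> 1"
    and \<sigma>: "0 < \<sigma>" "\<sigma> \<le> 2 / (Lyy + \<mu>)"
  obtains C where "C > 0"
    and "\<And>K xs ys. 2 \<le> K \<Longrightarrow>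
      cg_rpga L X Y (\<lambda>_. c * real K powr (-1/2)) (\<lambda>_. \<sigma>) x0 y0 xs ys \<Longrightarrow>
      \<exists>t\<in>{nat \<lceil>real K / 2\<rceil>..K - 1}. xs t \<in> X \<and> ys t \<in> Y \<and>
        gap_Z L X Y \<sigma> (xs t) (ys t) \<le> C * real K powr (-1/2)"
proof -
  obtain B where B: "\<And>y. y \<in> Y \<Longrightarrow> norm y \<le> B"
    using compact_imp_bounded[OF Y(3)] by (auto simp: bounded_iff)
  define R where "R = (norm (grad_x L x0 y0) + Lxx * D + Lyx * (B + B)) * D"
  have osc: "\<Phi> x - \<Phi> x' \<le> R" if "x \<in> X" "x' \<in> X" for x x'
    unfolding R_def
  proof (rule Phi_oscillation_le[OF that init])
    show "norm (y - y0) \<le> B + B" if "y \<in> Y" for y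
      using norm_triangle_ineq4[of y y0] B[OF that] B[OF init(2)] by linarith
  qed
  have R: "0 \<le> R" using osc[OF init(1) init(1)] by simp
  define q where "q = 1 / sqrt (1 + \<mu>\<^sup>2 * \<sigma>\<^sup>2)"
  have "1 < sqrt (1 + \<mu>\<^sup>2 * \<sigma>\<^sup>2)" using mu \<sigma>(1) by simp
  then have q: "0 < q" "q < 1" by (auto simp: q_def)
  define b where "b = Lyx * \<kappa> * D * c"
  have b: "0 \<le> b" using nonneg kappa_nonneg c by (simp add: b_def)
  define r0 where "r0 = sqrt (\<delta> x0 y0)"
  have r0: "0 \<le> r0" using delta_nonneg[OF init] by (simp add: r0_def)
  \<comment> \<open>Bounds \<open>sqrt \<delta>\<close> in units of \<open>K powr (-1/2)\<close> on
    the second half: \<open>2 * r0\<close> comes from the transient, \<open>b\<close> from the drift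
    of the primal point.\<close>
  define A where "A = (2 * r0 + b) / (1 - q)"
  have A: "0 \<le> A" using r0 b q by (simp add: A_def)
  define M where "M = (Lxx * (c * D) + Lyx * (\<kappa> * (A + A))) * D"
  have M: "0 \<le> M" using nonneg kappa_nonneg c A by (simp add: M_def)
  \<comment> \<open>The terms come from telescoping \<open>\<Phi>\<close>, the Frank-Wolfe error and
    the dual gap; the final 1 ensures positivity.\<close>
  define C where "C = 3 * R / c + M + \<kappa> / \<sigma> * A + 1"
  have "C > 0" unfolding C_def using R M A c \<sigma>(1) kappa_nonneg
    by (intro add_nonneg_pos add_nonneg_nonneg mult_nonneg_nonneg divide_nonneg_pos) auto
  moreover have "\<exists>t\<in>{nat \<lceil>real K / 2\<rceil>..K - 1}. xs t \<in> X \<and> ys t \<in> Y \<and>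
        gap_Z L X Y \<sigma> (xs t) (ys t) \<le> C * real K powr (-1/2)"
    if K: "2 \<le> K" and run: "cg_rpga L X Y (\<lambda>_. c * real K powr (-1/2)) (\<lambda>_. \<sigma>) x0 y0 xs ys"
    for K xs ys
  proof -
    define h where "h = real K powr (-1/2)"
    define \<tau> where "\<tau> = c * h"
    define r where "r = (\<lambda>k. sqrt (\<delta> (xs k) (ys k)))"
    define m where "m = nat \<lceil>real K / 2\<rceil>"
    have h: "0 < h" using K by (simp add: h_def)
    have hh: "h * h = 1 / real K"
      using K by (simp add: h_def powr_minus_divide flip: powr_add)
    have h1: "h \<le> 1" unfolding h_def using K powr_mono[of "-1/2" 0 "real K"] by simp
    have Kh: "1 / real K \<le> h" using mult_left_mono[OF h1, of h] h hh by simp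
    have \<tau>: "0 < \<tau>" "\<tau> \<le> 1" using c h h1 by (auto simp: \<tau>_def mult_le_one)
    have run': "cg_rpga L X Y (\<lambda>_. \<tau>) (\<lambda>_. \<sigma>) x0 y0 xs ys" using run by (simp add: \<tau>_def h_def)
    note mem = cg_rpga_iterates[OF run' init less_imp_le[OF \<tau>(1)] \<tau>(2)]
    note step = cg_rpga_step[OF run' init less_imp_le[OF \<tau>(1)] \<tau>(2) \<sigma>]
    \<comment> \<open>The indices \<open>m..<K\<close> make up at least a third of the run, with
      equality at \<open>K = 3\<close>; this is the source of the factor 3.\<close>
    have m: "real K / 2 \<le> real m" "3 * (K - m) \<ge> K" "m < K" "0 < m"
    proof -
      show "real K / 2 \<le> real m" unfolding m_def by (rule real_nat_ceiling_ge)
      have "real m < real K / 2 + 1" unfolding m_def by linarith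
      then have "2 * m < K + 2" by linarith
      moreover have "K \<le> 2 * m" using \<open>real K / 2 \<le> real m\<close> by linarith
      ultimately show "3 * (K - m) \<ge> K" "m < K" "0 < m" using K by presburger+
    qed
    have tail: "r k \<le> A * h" if "m \<le> k" for k
    proof -
      have k: "real K / 2 \<le> real k" "0 < k" using m that by linarith+
      have "r k \<le> q ^ k * r 0 + b * h / (1 - q)"
      proof (rule affine_recursion_le)
        show "r (Suc k) \<le> q * r k + b * h" for k
          using step(1)[of k] by (simp add: r_def q_def b_def \<tau>_def mult.assoc)
      qed (use q b h in auto)
      also have "r 0 = r0" using run by (simp add: r_def r0_def cg_rpga_def)
      finally have "r k \<le> q ^ k * r0 + b * h / (1 - q)" .
      moreover have "q ^ k * r0 \<le> 2 * h / (1 - q) * r0"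
      proof (rule mult_right_mono[OF _ r0])
        have "q ^ k \<le> 1 / real k * (1 / (1 - q))"
          using geometric_power_le[OF q k(2)] by simp
        also have "\<dots> \<le> (2 / real K) * (1 / (1 - q))"
          using k K q by (intro mult_right_mono) (auto simp: field_simps)
        \<comment> \<open>Since \<open>h \<le> 1\<close>, the \<open>1/K\<close> decay of the
          transient is dominated by \<open>h\<close>, whose square is \<open>1/K\<close>.\<close>
        also have "\<dots> \<le> (2 * h) * (1 / (1 - q))"
          using Kh q by (intro mult_right_mono) (auto simp: field_simps)
        finally show "q ^ k \<le> 2 * h / (1 - q)" by simp
      qed
      ultimately show ?thesis by (simp add: A_def add_divide_distrib algebra_simps)
    qed
    have gapY: "gap_Y L Y \<sigma> (xs k) (ys k) \<le> \<kappa> / \<sigma> * A * h" if "m \<le> k" for k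
      using step(2)[of k] mult_left_mono[OF tail[OF that], of "\<kappa> / \<sigma>"] kappa_nonneg \<sigma>(1)
      by (simp add: r_def)
    have gapX: "\<tau> * gap_X L X (xs k) (ys k) \<le> \<Phi> (xs k) - \<Phi> (xs (Suc k)) + \<tau> * (M * h)"
      if "m \<le> k" for k
    proof -
      have "(Lxx * (\<tau> * D) + Lyx * (\<kappa> * (r k + r (Suc k)))) * (\<tau> * D)
          \<le> (Lxx * (\<tau> * D) + Lyx * (\<kappa> * (A * h + A * h))) * (\<tau> * D)"
        using nonneg kappa_nonneg \<tau> tail that
        by (intro mult_right_mono mult_left_mono add_mono order_refl) auto
      also have "\<dots> = \<tau> * (M * h)" by (simp add: M_def \<tau>_def algebra_simps)
      finally show ?thesis using step(3)[of k] by (simp add: r_def)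
    qed
    \<comment> \<open>If every primal gap in the second half exceeded \<open>v\<close>, telescoping
      would make \<open>\<Phi>\<close> decrease by more than its oscillation
      \<open>R\<close>.\<close>
    define v where "v = (3 * R / c + M) * h"
    obtain t where t: "m \<le> t" "t < K" "gap_X L X (xs t) (ys t) \<le> v"
    proof (rule ccontr)
      assume "\<not> thesis"
      then have gt: "v < gap_X L X (xs k) (ys k)" if "m \<le> k" "k < K" for k
        using that \<open>\<And>t. m \<le> t \<Longrightarrow> t < K \<Longrightarrow> gap_X L X (xs t) (ys t) \<le> v \<Longrightarrow> thesis\<close> by force
      define n where "n = real (K - m)"
      have "n * (\<tau> * v) = (\<Sum>k=m..<K. \<tau> * v)" by (simp add: n_def)
      also have "\<dots> < (\<Sum>k=m..<K. \<Phi> (xs k) - \<Phi> (xs (Suc k)) + \<tau> * (M * h))"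
      proof (rule sum_strict_mono)
        fix k assume "k \<in> {m..<K}"
        then show "\<tau> * v < \<Phi> (xs k) - \<Phi> (xs (Suc k)) + \<tau> * (M * h)"
          using mult_strict_left_mono[OF gt \<tau>(1), of k] gapX[of k] by simp
      qed (use m in auto)
      also have "\<dots> = \<Phi> (xs m) - \<Phi> (xs K) + n * (\<tau> * (M * h))"
        using sum_Suc_diff'[of m K "\<lambda>k. - \<Phi> (xs k)"] m by (simp add: sum.distrib n_def)
      also have "\<dots> \<le> R + n * (\<tau> * (M * h))"
        using osc[OF mem(1) mem(1)] by simp
      finally have "n * (\<tau> * (3 * R / c * h)) < R" by (simp add: v_def algebra_simps)
      \<comment> \<open>\<open>\<tau> * h = c / K\<close> cancels the \<open>c\<close> in
        \<open>v\<close>, and \<open>3 * n \<ge> K\<close> makes the factor at least 1.\<close>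
      moreover have "n * (\<tau> * (3 * R / c * h)) = (3 * n / real K) * R"
      proof -
        have "n * (\<tau> * (3 * R / c * h)) = (h * h) * (3 * n * R)"
          using c by (simp add: \<tau>_def field_simps)
        then show ?thesis by (simp add: hh)
      qed
      moreover have "1 * R \<le> (3 * n / real K) * R"
        using m(2) K R by (intro mult_right_mono) (simp_all add: n_def field_simps flip: of_nat_mult)
      ultimately show False by linarith
    qed
    have "gap_Z L X Y \<sigma> (xs t) (ys t) \<le> v + \<kappa> / \<sigma> * A * h"
      using t(3) gapY[OF t(1)] by (simp add: gap_Z_def)
    also have "\<dots> \<le> C * h" using h by (simp add: v_def C_def algebra_simps)
    finally show ?thesis
      using t mem by (intro bexI[of _ t]) (auto simp: h_def m_def)
  qed
  ultimately show thesis by (rule that)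
qed

end

section \<open>Convergence rate and iteration complexity\<close>

theorem theorem5p3:
  fixes L :: "'a::real_normed_vector \<Rightarrow> 'b::euclidean_space \<Rightarrow> real"
    and X :: "'a set" and Y :: "'b set"
    and Lxx Lyx Lyy \<mu>' c \<sigma> :: real
    and x0 :: 'a and y0 :: 'b
  assumes fin_dim: "\<exists>B::'a set. finite B \<and> span B = UNIV"
    and X: "X \<noteq> {}" "convex X" "compact X"
    and Y: "Y \<noteq> {}" "convex Y" "compact Y"
    and L_nonneg: "Lxx \<ge> 0" "Lyx > 0" "Lyy \<ge> 0"
    and diff_x: "\<And>x y. x \<in> X \<Longrightarrow> y \<in> Y \<Longrightarrow> (\<lambda>u. L u y) differentiable (at x)"
    and C1_x: "\<And>y. y \<in> Y \<Longrightarrow> continuous_on X (\<lambda>x. grad_x L x y)"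
    and lip_x: "\<And>x xb y yb. x \<in> X \<Longrightarrow> xb \<in> X \<Longrightarrow> y \<in> Y \<Longrightarrow> yb \<in> Y \<Longrightarrow>
      norm (grad_x L x y - grad_x L xb yb) \<le> Lxx * norm (x - xb) + Lyx * norm (y - yb)"
    and concave_y: "\<And>x. x \<in> X \<Longrightarrow> concave_on Y (L x)"
    and diff_y: "\<And>x y. x \<in> X \<Longrightarrow> y \<in> Y \<Longrightarrow> L x differentiable (at y)"
    and C1_y: "\<And>x. x \<in> X \<Longrightarrow> continuous_on Y (\<lambda>y. grad_y L x y)"
    and lip_y: "\<And>x xb y yb. x \<in> X \<Longrightarrow> xb \<in> X \<Longrightarrow> y \<in> Y \<Longrightarrow> yb \<in> Y \<Longrightarrow>
      norm (grad_y L x y - grad_y L xb yb) \<le> Lyx * norm (x - xb) + Lyy * norm (y - yb)"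
    and strong: "\<mu>' > 0" "\<And>x. x \<in> X \<Longrightarrow> strongly_concave_y \<mu>' L Y x"
    and init: "x0 \<in> X" "y0 \<in> Y"
    and c: "0 < c" "c \<le> 1"
    and \<sigma>: "0 < \<sigma>" "\<sigma> \<le> 2 / (Lyy + \<mu>')"
  shows
    "(\<exists>C>0. \<forall>K::nat\<ge>2. \<forall>xs ys.
        cg_rpga L X Y (\<lambda>_. c * real K powr (-1/2)) (\<lambda>_. \<sigma>) x0 y0 xs ys \<longrightarrow>
        (\<exists>t\<in>{nat \<lceil>real K / 2\<rceil>..K - 1}. xs t \<in> X \<and> ys t \<in> Y \<and>
           gap_Z L X Y \<sigma> (xs t) (ys t) \<le> C * real K powr (-1/2)))
     \<and>
     (\<exists>C'>0. \<forall>\<epsilon>::real. 0 < \<epsilon> \<and> \<epsilon> < 1 \<longrightarrow> (\<forall>K xs ys. K = nat \<lceil>C' * \<epsilon> powr (-2)\<rceil> \<longrightarrow>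
        cg_rpga L X Y (\<lambda>_. c * real K powr (-1/2)) (\<lambda>_. \<sigma>) x0 y0 xs ys \<longrightarrow>
        (\<exists>t\<in>{nat \<lceil>real K / 2\<rceil>..K - 1}. xs t \<in> X \<and> ys t \<in> Y \<and>
           gap_Z L X Y \<sigma> (xs t) (ys t) \<le> \<epsilon>)))"
proof -
  obtain B where B: "\<And>x. x \<in> X \<Longrightarrow> norm x \<le> B"
    using compact_imp_bounded[OF X(3)] by (auto simp: bounded_iff)
  \<comment> \<open>Compactness of \<open>X\<close> supplies the diameter bound as twice a norm
    bound; the Lipschitz estimate in \<open>y\<close> is the case of equal primal points.\<close>
  interpret nonconvex_strongly_concave L X Y Lxx Lyx Lyy \<mu>' "B + B"
  proof
    show "norm (x - x') \<le> B + B" if "x \<in> X" "x' \<in> X" for x x'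
      using norm_triangle_ineq4[of x x'] B[OF that(1)] B[OF that(2)] by linarith
    show "0 \<le> B + B" using B[OF init(1)] norm_ge_zero[of x0] by linarith
    show "norm (grad_y L x y - grad_y L x y') \<le> Lyy * norm (y - y')"
      if "x \<in> X" "y \<in> Y" "y' \<in> Y" for x y y'
      using lip_y[of x x y y'] that by simp
  qed (use X Y L_nonneg diff_x lip_x diff_y strong in auto)
  obtain C where C: "C > 0" and gap: "\<And>K xs ys. 2 \<le> K \<Longrightarrow>
      cg_rpga L X Y (\<lambda>_. c * real K powr (-1/2)) (\<lambda>_. \<sigma>) x0 y0 xs ys \<Longrightarrow>
      \<exists>t\<in>{nat \<lceil>real K / 2\<rceil>..K - 1}. xs t \<in> X \<and> ys t \<in> Y \<and>
        gap_Z L X Y \<sigma> (xs t) (ys t) \<le> C * real K powr (-1/2)"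
    using cg_rpga_gap_bound[OF init c \<sigma>] by metis
  \<comment> \<open>The 2 forces \<open>K \<ge> 2\<close> for every \<open>\<epsilon> < 1\<close>;
    the square of \<open>C\<close> gives \<open>C / sqrt K \<le> \<epsilon>\<close>.\<close>
  define C' where "C' = max 2 (C\<^sup>2)"
  have C': "C' > 0" by (simp add: C'_def)
  have "2 \<le> K \<and> C * real K powr (-1/2) \<le> \<epsilon>"
    if \<epsilon>: "0 < \<epsilon>" "\<epsilon> < 1" and K: "K = nat \<lceil>C' * \<epsilon> powr (-2)\<rceil>" for \<epsilon> :: real and K :: nat
  proof
    have e2: "\<epsilon> powr (-2) = 1 / \<epsilon>\<^sup>2"
      using \<epsilon> by (simp add: powr_minus_divide powr_numeral)
    have K_ge: "C' / \<epsilon>\<^sup>2 \<le> real K" unfolding K e2 by (simp add: real_nat_ceiling_ge)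
    have "\<epsilon>\<^sup>2 \<le> 1" using \<epsilon> by (simp add: power_le_one)
    then have "C' \<le> C' / \<epsilon>\<^sup>2" using \<epsilon> C' by (simp add: field_simps)
    then show K2: "2 \<le> K" using K_ge by (simp add: C'_def)
    have "(C / \<epsilon>)\<^sup>2 \<le> C' / \<epsilon>\<^sup>2" by (simp add: power_divide C'_def divide_right_mono)
    then have "C / \<epsilon> \<le> sqrt (real K)" using K_ge by (intro real_le_rsqrt) linarith
    then have "C / sqrt (real K) \<le> \<epsilon>" using \<epsilon> K2 by (simp add: field_simps)
    then show "C * real K powr (-1/2) \<le> \<epsilon>"
      using K2 by (simp add: powr_minus_divide powr_half_sqrt)
  qed
  note rate = this
  show ?thesis
  proof (rule conjI)
    show "\<exists>C>0. \<forall>K::nat\<ge>2. \<forall>xs ys.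
        cg_rpga L X Y (\<lambda>_. c * real K powr (-1/2)) (\<lambda>_. \<sigma>) x0 y0 xs ys \<longrightarrow>
        (\<exists>t\<in>{nat \<lceil>real K / 2\<rceil>..K - 1}. xs t \<in> X \<and> ys t \<in> Y \<and>
           gap_Z L X Y \<sigma> (xs t) (ys t) \<le> C * real K powr (-1/2))"
      using C gap by blast
  next
    show "\<exists>C'>0. \<forall>\<epsilon>::real. 0 < \<epsilon> \<and> \<epsilon> < 1 \<longrightarrow> (\<forall>K xs ys. K = nat \<lceil>C' * \<epsilon> powr (-2)\<rceil> \<longrightarrow>
        cg_rpga L X Y (\<lambda>_. c * real K powr (-1/2)) (\<lambda>_. \<sigma>) x0 y0 xs ys \<longrightarrow>
        (\<exists>t\<in>{nat \<lceil>real K / 2\<rceil>..K - 1}. xs t \<in> X \<and> ys t \<in> Y \<and>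
           gap_Z L X Y \<sigma> (xs t) (ys t) \<le> \<epsilon>))"
    proof (intro exI[of _ C'] conjI allI impI)
      fix \<epsilon> :: real and K :: nat and xs ys
      assume "0 < \<epsilon> \<and> \<epsilon> < 1" "K = nat \<lceil>C' * \<epsilon> powr (-2)\<rceil>"
        and run: "cg_rpga L X Y (\<lambda>_. c * real K powr (-1/2)) (\<lambda>_. \<sigma>) x0 y0 xs ys"
      then have K: "2 \<le> K" "C * real K powr (-1/2) \<le> \<epsilon>" using rate by blast+
      obtain t where "t \<in> {nat \<lceil>real K / 2\<rceil>..K - 1}" "xs t \<in> X" "ys t \<in> Y"
        "gap_Z L X Y \<sigma> (xs t) (ys t) \<le> C * real K powr (-1/2)"
        using gap[OF K(1) run] by blast
      then show "\<exists>t\<in>{nat \<lceil>real K / 2\<rceil>..K - 1}. xs t \<in> X \<and> ys t \<in> Y \<and>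
          gap_Z L X Y \<sigma> (xs t) (ys t) \<le> \<epsilon>"
        using K(2) order_trans by blast
    qed (fact C')
  qed
qed

end
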